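(* Let $V$ be a valuation domain of rank one with quotient field $K$, and let $\delta\in\mathbb{R}$. Then $\mathcal{V}(\bullet,\delta)$ is the completion of its subset $\mathcal{V}_K(\bullet,\delta)$ under the metric $d_\delta$. In particular, $\mathcal{V}(\bullet,\delta)$, under $d_\delta$, is a complete metric space.
   Context: $v$ is the valuation associated to $V$, with value group $\Gamma_v\subseteq\mathbb{R}$, and $d(x,y)=e^{-v(x-y)}$ for $x,y\in K$. A sequence $E=\{s_n\}_{n\in\mathbb{N}}$ in $K$ is pseudo-convergent if $v(s_{n+1}-s_n)<v(s_{n+2}-s_{n+1})$ for all $n$. Its breadth is $\delta_E=\lim_{n\to\infty}v(s_{n+1}-s_n)\in\mathbb{R}\cup\{\infty\}$. An element $\alpha\in K$ is a pseudo-limit of $E$ if $v(\alpha-s_n)<v(\alpha-s_{n+1})$ for all $n$. For a pseudo-convergent sequence $E$, $V_E=\{\phi\in K(X)\mid \phi(s_n)\in V\text{ for all but finitely many }n\in\mathbb{N}\}$; this is a valuation domain of $K(X)$ with $V_E\cap K=V$. $\mathcal{V}(\bullet,\delta)$ is the set of rings $V_E$, where $E$ ranges over the pseudo-convergent sequences in $K$ of breadth $\delta$; $\mathcal{V}_K(\bullet,\delta)$ is the subset of those $V_E$ where $E$ (of breadth $\delta$) has a pseudo-limit in $K$. The metric $d_\delta$ on $\mathcal{V}(\bullet,\delta)$ is the (well-defined) ultrametric distance given by $d_\delta(V_E,V_F)=\lim_{n\to\infty}\max\{d(s_n,t_n)-e^{-\delta},0\}$ for $E=\{s_n\}_{n\in\mathbb{N}}$,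 $F=\{t_n\}_{n\in\mathbb{N}}$ pseudo-convergent of breadth $\delta$. *)

theory Defs
  imports
    "HOL-Analysis.Analysis"
    "HOL-Computational_Algebra.Fraction_Field"
    "HOL-Algebra.Algebraic_Closure_Type"
begin

text \<open>
  The field \<open>K\<close> is a type of class \<open>field\<close>; \<open>V\<close> is a subset of it. The last condition of
  \<open>valuation_domain_of\<close> says at once that \<open>K\<close> is the quotient field of \<open>V\<close> and that \<open>V\<close> is a
  valuation domain.
\<close>

definition valuation_domain_of :: "'a::field set \<Rightarrow> bool" where
  "valuation_domain_of V \<longleftrightarrow>
     subdomain V (ring_of_type_algebra :: 'a ring) \<and>
     (\<forall>x. x \<noteq> 0 \<longrightarrow> x \<in> V \<or> inverse x \<in> V)"

definition krull_dim_one :: "('a, 'b) ring_scheme \<Rightarrow> bool" where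
  "krull_dim_one R \<longleftrightarrow>
     (\<exists>P Q. primeideal P R \<and> primeideal Q R \<and> P \<subset> Q) \<and>
     \<not> (\<exists>P Q S. primeideal P R \<and> primeideal Q R \<and> primeideal S R \<and> P \<subset> Q \<and> Q \<subset> S)"

text \<open>The rank of a valuation domain is its Krull dimension.\<close>

definition rank_one_valuation_domain :: "'a::field set \<Rightarrow> bool" where
  "rank_one_valuation_domain V \<longleftrightarrow>
     valuation_domain_of V \<and>
     krull_dim_one ((ring_of_type_algebra :: 'a ring)\<lparr>carrier := V\<rparr>)"

text \<open>
  An additive valuation with value group in the reals, and \<open>v 0 = \<infinity>\<close>, whose valuation ring is \<open>V\<close>.
  It is determined by \<open>V\<close> up to a positive real factor.
\<close>

definition real_valuation_of :: "'a::field set \<Rightarrow> ('a \<Rightarrow> ereal) \<Rightarrow> bool" where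
  "real_valuation_of V v \<longleftrightarrow>
     (\<forall>x. v x \<noteq> -\<infinity>) \<and>
     (\<forall>x. v x = \<infinity> \<longleftrightarrow> x = 0) \<and>
     (\<forall>x y. v (x * y) = v x + v y) \<and>
     (\<forall>x y. min (v x) (v y) \<le> v (x + y)) \<and>
     V = {x. 0 \<le> v x}"

definition val_dist :: "('a::field \<Rightarrow> ereal) \<Rightarrow> 'a \<Rightarrow> 'a \<Rightarrow> real" where
  "val_dist v x y = (if x = y then 0 else exp (- real_of_ereal (v (x - y))))"

definition pseudo_convergent :: "('a::field \<Rightarrow> ereal) \<Rightarrow> (nat \<Rightarrow> 'a) \<Rightarrow> bool" where
  "pseudo_convergent v s \<longleftrightarrow>
     (\<forall>n. v (s (n + 1) - s n) < v (s (n + 2) - s (n + 1)))"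

definition breadth :: "('a::field \<Rightarrow> ereal) \<Rightarrow> (nat \<Rightarrow> 'a) \<Rightarrow> ereal" where
  "breadth v s = lim (\<lambda>n. v (s (n + 1) - s n))"

definition pseudo_limit :: "('a::field \<Rightarrow> ereal) \<Rightarrow> (nat \<Rightarrow> 'a) \<Rightarrow> 'a \<Rightarrow> bool" where
  "pseudo_limit v s \<alpha> \<longleftrightarrow> (\<forall>n. v (\<alpha> - s n) < v (\<alpha> - s (n + 1)))"

text \<open>
  \<open>ratfun_value \<phi> x y\<close>: the rational function \<open>\<phi>\<close> is defined at \<open>x\<close>, with value \<open>y\<close>. A relation is
  used because \<open>\<phi>\<close> may have a pole at \<open>x\<close>.
\<close>

definition ratfun_value :: "'a::field poly fract \<Rightarrow> 'a \<Rightarrow> 'a \<Rightarrow> bool" where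
  "ratfun_value \<phi> x y \<longleftrightarrow>
     (\<exists>p q. \<phi> = Fraction_Field.Fract p q \<and> poly q x \<noteq> 0 \<and> y = poly p x / poly q x)"

text \<open>\<open>seq_ring V s\<close> is the ring \<open>V\<^sub>E\<close> for \<open>E = s\<close>.\<close>

definition seq_ring :: "'a::field set \<Rightarrow> (nat \<Rightarrow> 'a) \<Rightarrow> 'a poly fract set" where
  "seq_ring V s = {\<phi>. \<forall>\<^sub>F n in sequentially. \<exists>y\<in>V. ratfun_value \<phi> (s n) y}"

definition seq_rings ::
    "'a::field set \<Rightarrow> ('a \<Rightarrow> ereal) \<Rightarrow> real \<Rightarrow> 'a poly fract set set" where
  "seq_rings V v \<delta> =
     {seq_ring V s | s. pseudo_convergent v s \<and> breadth v s = ereal \<delta>}"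

definition seq_rings_K ::
    "'a::field set \<Rightarrow> ('a \<Rightarrow> ereal) \<Rightarrow> real \<Rightarrow> 'a poly fract set set" where
  "seq_rings_K V v \<delta> =
     {seq_ring V s | s. pseudo_convergent v s \<and> breadth v s = ereal \<delta> \<and> (\<exists>\<alpha>. pseudo_limit v s \<alpha>)}"

text \<open>
  The limit must be the same for all sequences representing the two rings. The value \<open>0\<close> outside
  \<open>seq_rings V v \<delta>\<close> is a dummy, as \<open>Metric_space\<close> requires nonnegativity and symmetry on the whole type.
\<close>

definition d_delta ::
    "'a::field set \<Rightarrow> ('a \<Rightarrow> ereal) \<Rightarrow> real \<Rightarrow> 'a poly fract set \<Rightarrow> 'a poly fract set \<Rightarrow> real" where
  "d_delta V v \<delta> A B =
     (if A \<in> seq_rings V v \<delta> \<and> B \<in> seq_rings V v \<delta> then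
        (THE r. \<forall>s t.
           pseudo_convergent v s \<and> breadth v s = ereal \<delta> \<and> seq_ring V s = A \<and>
           pseudo_convergent v t \<and> breadth v t = ereal \<delta> \<and> seq_ring V t = B \<longrightarrow>
           (\<lambda>n. max (val_dist v (s n) (t n) - exp (- \<delta>)) 0) \<longlonglongrightarrow> r)
      else 0)"

text \<open>The metric space \<open>(M, d)\<close> is the completion of its subset \<open>S\<close> with the restricted metric.\<close>

definition is_completion_of_subset :: "'b set \<Rightarrow> ('b \<Rightarrow> 'b \<Rightarrow> real) \<Rightarrow> 'b set \<Rightarrow> bool" where
  "is_completion_of_subset M d S \<longleftrightarrow>
     Metric_space M d \<and> Metric_space.mcomplete M d \<and>
     S \<subseteq> M \<and> Metric_space.mtopology M d closure_of S = M"

end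

theory Submission
  imports Defs
begin

text \<open>
  In terms of the absolute value \<open>|x| = exp (- v x)\<close> and \<open>\<rho> = exp (- \<delta>)\<close>, the sequences in question are
  those whose consecutive distances decrease strictly to \<open>\<rho>\<close>. Along such a sequence \<open>|p(s\<^sub>n)|\<close> is
  eventually a monomial \<open>C |s\<^sub>n\<^sub>+\<^sub>1 - s\<^sub>n|\<^sup>k\<close> (Ostrowski, Kaplansky), so a rational function is either
  eventually integral or eventually not. If \<open>s\<close> and \<open>t\<close> are at distance \<open>0\<close>, some sequence of the same
  kind visits both infinitely often, so \<open>V\<^sub>s = V\<^sub>t\<close>; the converse is seen on the functions
  \<open>(X - s\<^sub>m) / (s\<^sub>m\<^sub>+\<^sub>1 - s\<^sub>m)\<close>. Hence \<open>d\<^sub>\<delta>\<close> is a well-defined metric.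

  Fix one such sequence with consecutive differences \<open>y\<^sub>j\<close>. If \<open>|x\<^sub>j\<^sub>+\<^sub>1 - x\<^sub>j| < |y\<^sub>j|\<close> for all \<open>j\<close>, then
  \<open>x\<^sub>j + y\<^sub>j\<close> is again such a sequence. With \<open>x\<^sub>j = s\<^sub>m\<close> constant it has the pseudo-limit \<open>s\<^sub>m\<close> and
  approximates \<open>s\<close>, which gives density; with \<open>x\<^sub>j\<close> a late term of the \<open>j\<close>-th member of a fast Cauchy
  sequence it is the limit, which gives completeness.
\<close>

subsection \<open>Polynomials and eventually dominant terms\<close>

text \<open>The \<open>c i\<close> are the Hasse derivatives of \<open>p\<close>, obtained by
  induction from p(x + h) without dividing by factorials, so any characteristic is allowed. The
  degree bound is what later permits an induction on the degree.\<close>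

lemma poly_taylor_coeffs:
  fixes p :: "'a::comm_ring_1 poly"
  shows "\<exists>c. (\<forall>x h. poly p (x + h) = (\<Sum>i\<le>Polynomial.degree p. poly (c i) x * h ^ i)) \<and>
             (\<forall>i. Polynomial.degree (c i) \<le> Polynomial.degree p - i)"
proof (induction p)
  case 0
  show ?case by (intro exI[of _ "\<lambda>_. 0"]) simp
next
  case (pCons a p)
  then obtain c where c: "\<And>x h. poly p (x + h) = (\<Sum>i\<le>Polynomial.degree p. poly (c i) x * h ^ i)"
    and deg: "\<And>i. Polynomial.degree (c i) \<le> Polynomial.degree p - i" by blast
  show ?case
  proof (cases "p = 0")
    case True
    then show ?thesis
      by (intro exI[of _ "\<lambda>i. [:a:]"]) simp
  next
    case False
    define d where "d = Polynomial.degree p"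
    have dp: "Polynomial.degree (pCons a p) = Suc d" using False by (simp add: d_def)
    \<comment> \<open>These are the coefficients of a + (x + h) * p(x + h): the factor x turns
      \<open>c i\<close> into \<open>pCons 0 (c i)\<close>, the factor h shifts the index. The first
      contribution is cut off beyond \<open>d\<close>, where \<open>pCons\<close> would break the
      degree bound.\<close>
    define e where "e i = (if i = 0 then pCons a (c 0)
        else (if i \<le> d then pCons 0 (c i) else 0) + c (i - 1))" for i
    have "poly (pCons a p) (x + h) = (\<Sum>i\<le>Suc d. poly (e i) x * h ^ i)" for x h
    proof -
      have "(\<Sum>i\<le>Suc d. poly (e i) x * h ^ i)
          = a + x * poly (c 0) x + (\<Sum>i\<le>d. poly (e (Suc i)) x * h ^ Suc i)"
        by (subst sum.atMost_Suc_shift) (simp add: e_def)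
      also have "(\<Sum>i\<le>d. poly (e (Suc i)) x * h ^ Suc i)
          = (\<Sum>i\<le>d. if Suc i \<le> d then x * poly (c (Suc i)) x * h ^ Suc i else 0)
            + (\<Sum>i\<le>d. poly (c i) x * h ^ Suc i)"
        unfolding sum.distrib[symmetric]
        by (rule sum.cong) (auto simp: e_def algebra_simps)
      also have "(\<Sum>i\<le>d. if Suc i \<le> d then x * poly (c (Suc i)) x * h ^ Suc i else 0)
          = (\<Sum>i<d. x * poly (c (Suc i)) x * h ^ Suc i)"
        by (simp add: sum.If_cases Suc_le_eq) (rule sum.cong, auto)
      also have "a + x * poly (c 0) x + ((\<Sum>i<d. x * poly (c (Suc i)) x * h ^ Suc i)
            + (\<Sum>i\<le>d. poly (c i) x * h ^ Suc i))
          = a + x * (\<Sum>i\<le>d. poly (c i) x * h ^ i) + h * (\<Sum>i\<le>d. poly (c i) x * h ^ i)"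
        by (subst (2) sum.atMost_shift) (simp add: sum_distrib_left algebra_simps)
      also have "\<dots> = a + (x + h) * poly p (x + h)"
        by (simp add: c[of x h] d_def distrib_right)
      finally show ?thesis by simp
    qed
    moreover have "Polynomial.degree (e i) \<le> Suc d - i" for i
    proof (cases "i = 0")
      case True
      then show ?thesis using deg[of 0] degree_pCons_le[of a "c 0"] by (simp add: e_def d_def)
    next
      case False
      have "Polynomial.degree (if i \<le> d then pCons 0 (c i) else 0) \<le> Suc d - i"
        using deg[of i] degree_pCons_le[of 0 "c i"] by (auto simp: d_def)
      moreover have "Polynomial.degree (c (i - 1)) \<le> Suc d - i"
        using deg[of "i - 1"] False by (auto simp: d_def)
      ultimately show ?thesis using False by (auto simp: e_def intro: degree_add_le)
    qed
    ultimately show ?thesis unfolding dp by blast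
  qed
qed

text \<open>After division by \<open>r n ^ i\<close>, the constant \<open>A\<close> is compared with
  \<open>B * r n ^ (j - i)\<close>, which tends to its limit strictly from above. This strictness
  also settles the case in which \<open>A\<close> equals the limit.\<close>

lemma monomials_eventually_ordered:
  fixes r :: "nat \<Rightarrow> real"
  assumes r: "r \<longlonglongrightarrow> \<rho>" "\<And>n. \<rho> < r n" and "0 < \<rho>" "0 < A" "0 < B" "i < j"
  shows "(\<forall>\<^sub>F n in sequentially. A * r n ^ i < B * r n ^ j) \<or>
         (\<forall>\<^sub>F n in sequentially. B * r n ^ j < A * r n ^ i)"
proof -
  have pos: "0 < r n" for n using r(2)[of n] \<open>0 < \<rho>\<close> by linarith
  have split: "r n ^ j = r n ^ i * r n ^ (j - i)" for n
    using \<open>i < j\<close> by (simp add: power_add[symmetric])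
  show ?thesis
  proof (cases "A \<le> B * \<rho> ^ (j - i)")
    case True
    have "A * r n ^ i < B * r n ^ j" for n
    proof -
      have "\<rho> ^ (j - i) < r n ^ (j - i)"
        using r(2)[of n] \<open>0 < \<rho>\<close> \<open>i < j\<close> by (intro power_strict_mono) auto
      then have "A < B * r n ^ (j - i)" using True \<open>0 < B\<close>
        by (meson mult_strict_left_mono order_le_less_trans)
      then have "A * r n ^ i < (B * r n ^ (j - i)) * r n ^ i"
        using pos[of n] by (intro mult_strict_right_mono) auto
      then show ?thesis by (simp add: split algebra_simps)
    qed
    then show ?thesis by simp
  next
    case False
    have "(\<lambda>n. B * r n ^ (j - i)) \<longlonglongrightarrow> B * \<rho> ^ (j - i)" by (intro tendsto_intros r)
    then have "\<forall>\<^sub>F n in sequentially. B * r n ^ (j - i) < A"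
      using False by (intro order_tendstoD(2)) auto
    then have "\<forall>\<^sub>F n in sequentially. B * r n ^ j < A * r n ^ i"
    proof eventually_elim
      case (elim n)
      then have "(B * r n ^ (j - i)) * r n ^ i < A * r n ^ i"
        using pos[of n] by (intro mult_strict_right_mono) auto
      then show ?case by (simp add: split algebra_simps)
    qed
    then show ?thesis by simp
  qed
qed

text \<open>Each of the finitely many comparisons is settled from some index on, so the largest term
  has the same index \<open>k\<close> for all late \<open>n\<close>.\<close>

lemma eventually_dominant:
  fixes f :: "'i \<Rightarrow> nat \<Rightarrow> real"
  assumes "finite S" "S \<noteq> {}"
    and "\<And>i j. \<lbrakk>i \<in> S; j \<in> S; i \<noteq> j\<rbrakk> \<Longrightarrow>
      (\<forall>\<^sub>F n in sequentially. f i n < f j n) \<or> (\<forall>\<^sub>F n in sequentially. f j n < f i n)"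
  shows "\<exists>k\<in>S. \<forall>\<^sub>F n in sequentially. \<forall>i\<in>S - {k}. f i n < f k n"
  using assms
proof (induction S rule: finite_ne_induct)
  case (singleton x)
  then show ?case by simp
next
  case (insert x F)
  then obtain k where k: "k \<in> F" "\<forall>\<^sub>F n in sequentially. \<forall>i\<in>F - {k}. f i n < f k n"
    by (metis (no_types, lifting) insertCI)
  have "x \<noteq> k" using k insert.hyps by blast
  then consider "\<forall>\<^sub>F n in sequentially. f x n < f k n" | "\<forall>\<^sub>F n in sequentially. f k n < f x n"
    using insert.prems[of x k] k(1) by blast
  then show ?case
  proof cases
    case 1
    with k(2) have "\<forall>\<^sub>F n in sequentially. \<forall>i\<in>insert x F - {k}. f i n < f k n"
      by eventually_elim auto
    then show ?thesis using k(1) by blast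
  next
    case 2
    with k(2) have "\<forall>\<^sub>F n in sequentially. \<forall>i\<in>insert x F - {x}. f i n < f x n"
    proof eventually_elim
      case (elim n)
      then show ?case by (metis DiffE DiffI insertE insertI1 less_trans singletonD singletonI)
    qed
    then show ?thesis by blast
  qed
qed

subsection \<open>Values of polynomials along pseudo-convergent sequences\<close>

text \<open>The valuation in multiplicative form: the infinite value becomes 0 and all limits are
  limits of real numbers. The constant \<rho> will be exp(-\<delta>).\<close>

locale nonarch_abs =
  fixes N :: "'a::field \<Rightarrow> real" and \<rho> :: real
  assumes N_nonneg [simp]: "0 \<le> N x"
    and N_eq_0_iff [simp]: "N x = 0 \<longleftrightarrow> x = 0"
    and N_mult: "N (x * y) = N x * N y"
    and N_add_le: "N (x + y) \<le> max (N x) (N y)"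
    and rho_pos: "0 < \<rho>"
begin

lemma N_0 [simp]: "N 0 = 0" by simp

lemma N_pos_iff [simp]: "0 < N x \<longleftrightarrow> x \<noteq> 0"
  using N_nonneg[of x] N_eq_0_iff[of x] by linarith

lemma N_1 [simp]: "N 1 = 1"
  using N_mult[of 1 1] N_eq_0_iff[of 1] by simp

lemma N_minus [simp]: "N (- x) = N x"
proof -
  have "(N (-1))\<^sup>2 = 1" using N_mult[of "-1" "-1"] by (simp add: power2_eq_square)
  then have "N (-1) = 1" using N_nonneg[of "-1"] by (auto simp: power2_eq_1_iff)
  then show ?thesis using N_mult[of "-1" x] by simp
qed

lemma N_commute: "N (x - y) = N (y - x)"
  using N_minus[of "x - y"] by simp

lemma N_diff_le: "N (x - y) \<le> max (N x) (N y)"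
  using N_add_le[of x "- y"] by simp

lemma N_triangle: "N (x - z) \<le> max (N (x - y)) (N (y - z))"
  using N_add_le[of "x - y" "y - z"] by simp

lemma N_add_eq: "N y < N x \<Longrightarrow> N (x + y) = N x"
  using N_add_le[of x y] N_diff_le[of "x + y" y] by auto

lemma N_power: "N (x ^ n) = N x ^ n"
  by (induction n) (simp_all add: N_mult)

lemma N_divide: "N (x / y) = N x / N y"
proof (cases "y = 0")
  case False
  then show ?thesis using N_mult[of "x / y" y] by (simp add: field_simps)
qed simp

lemma N_sum_less:
  assumes "finite A" "0 < c" "\<And>i. i \<in> A \<Longrightarrow> N (f i) < c"
  shows "N (sum f A) < c"
  using assms
proof (induction A rule: finite_induct)
  case (insert x F)
  then have "N (f x) < c" "N (sum f F) < c" by auto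
  then show ?case using insert.hyps N_add_le[of "f x" "sum f F"] by auto
qed simp

lemma N_sum_dominant:
  assumes "finite A" "k \<in> A" "f k \<noteq> 0" "\<And>i. i \<in> A - {k} \<Longrightarrow> N (f i) < N (f k)"
  shows "N (sum f A) = N (f k)"
proof -
  have "sum f A = f k + sum f (A - {k})" using assms by (simp add: sum.remove)
  moreover have "N (sum f (A - {k})) < N (f k)" using assms by (intro N_sum_less) auto
  ultimately show ?thesis by (simp add: N_add_eq)
qed

section \<open>Sequences whose gaps decrease strictly to \<rho>\<close>

definition gap :: "(nat \<Rightarrow> 'a) \<Rightarrow> nat \<Rightarrow> real" where
  "gap s n = N (s (Suc n) - s n)"

text \<open>Pseudo-convergence together with breadth \<open>- ln \<rho>\<close>.\<close>

definition pc :: "(nat \<Rightarrow> 'a) \<Rightarrow> bool" where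
  "pc s \<longleftrightarrow> (\<forall>n. gap s (Suc n) < gap s n) \<and> gap s \<longlonglongrightarrow> \<rho>"

lemma pc_tendsto: "pc s \<Longrightarrow> gap s \<longlonglongrightarrow> \<rho>"
  by (simp add: pc_def)

lemma pc_gap_less: "pc s \<Longrightarrow> m < n \<Longrightarrow> gap s n < gap s m"
  unfolding pc_def using lift_Suc_mono_less[of "\<lambda>n. - gap s n" m n] by auto

lemma pc_gap_gt: assumes "pc s" shows "\<rho> < gap s n"
proof -
  have "decseq (gap s)"
    using pc_gap_less[OF assms] by (intro decseq_SucI less_imp_le) simp
  then have "\<rho> \<le> gap s (Suc n)" using pc_tendsto[OF assms] by (rule decseq_ge)
  then show ?thesis using pc_gap_less[OF assms, of n "Suc n"] by simp
qed

text \<open>In the telescoping sum for \<open>s m - s n\<close> the first difference is strictly the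
  largest.\<close>

lemma pc_dist:
  assumes "pc s" "n < m" shows "N (s m - s n) = gap s n"
  using \<open>n < m\<close>
proof (induction m)
  case (Suc m)
  show ?case
  proof (cases "n = m")
    case True
    then show ?thesis by (simp add: gap_def)
  next
    case False
    then have IH: "N (s m - s n) = gap s n" using Suc by simp
    have "N (s (Suc m) - s m) < N (s m - s n)"
      using False Suc.prems IH pc_gap_less[OF assms(1), of n m] by (simp add: gap_def)
    from N_add_eq[OF this] show ?thesis using IH by simp
  qed
qed simp

lemma pc_dist_le:
  assumes "pc s" "n \<le> m" shows "N (s m - s n) \<le> gap s n"
  using pc_dist[OF assms(1), of n m] assms pc_gap_gt[OF assms(1), of n] rho_pos
  by (cases "n = m") auto

lemma pc_inj: assumes "pc s" shows "inj s"
proof (rule linorder_injI)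
  fix m n :: nat assume "m < n"
  then have "0 < N (s n - s m)"
    using pc_dist[OF assms] pc_gap_gt[OF assms, of m] rho_pos by simp
  then show "s m \<noteq> s n" by auto
qed

lemma pc_eventually_poly_nz:
  assumes "pc s" "p \<noteq> 0" shows "\<forall>\<^sub>F n in sequentially. poly p (s n) \<noteq> 0"
proof -
  have "finite (s -` {x. poly p x = 0})"
    using poly_roots_finite[OF assms(2)] pc_inj[OF assms(1)] by (intro finite_vimageI)
  then have "finite {n. \<not> poly p (s n) \<noteq> 0}" by (simp add: vimage_def)
  then show ?thesis by (simp add: cofinite_eq_sequentially[symmetric] eventually_cofinite)
qed

text \<open>
  Induction on the degree, without passing to an extension field that contains a pseudo-limit:
  expand \<open>p (s n)\<close> around \<open>s m\<close> with \<open>m\<close> large compared with \<open>n\<close>. The coefficients \<open>c i\<close> with \<open>i \<ge> 1\<close>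
  have smaller degree, so their values at \<open>s m\<close> are known and one term, of index \<open>k\<close>, dominates
  \<open>p (s n) - p (s m)\<close>. Either \<open>|p (s n)|\<close> is eventually constant or it equals this term.
\<close>

lemma pc_eventually_monomial:
  assumes s: "pc s" and "p \<noteq> 0"
  shows "\<exists>C k. 0 < C \<and> (\<forall>\<^sub>F n in sequentially. N (poly p (s n)) = C * gap s n ^ k)"
  using \<open>p \<noteq> 0\<close>
proof (induction "Polynomial.degree p" arbitrary: p rule: less_induct)
  case less
  let ?r = "gap s"
  have rgt: "\<rho> < ?r n" for n by (rule pc_gap_gt[OF s])
  have rpos: "0 < ?r n" for n using rgt[of n] rho_pos by linarith
  obtain c where c: "\<And>x h. poly p (x + h) = (\<Sum>i\<le>Polynomial.degree p. poly (c i) x * h ^ i)"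
    and deg: "\<And>i. Polynomial.degree (c i) \<le> Polynomial.degree p - i" using poly_taylor_coeffs[of p] by blast
  \<comment> \<open>For these indices \<open>c i\<close> is a nonzero polynomial of degree below
    that of \<open>p\<close>, so the induction hypothesis applies to it.\<close>
  define S where "S = {i. 1 \<le> i \<and> i \<le> Polynomial.degree p \<and> c i \<noteq> 0}"
  have "finite S" unfolding S_def by (rule finite_subset[of _ "{..Polynomial.degree p}"]) auto
  have c0: "poly (c 0) x = poly p x" for x
  proof -
    have "poly p (x + 0) = (\<Sum>i\<le>Polynomial.degree p. if i = 0 then poly (c i) x else 0)"
      unfolding c by (rule sum.cong) auto
    then show ?thesis by simp
  qed
  have diff: "poly p (x + h) - poly p x = (\<Sum>i\<in>S. poly (c i) x * h ^ i)" for x h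
  proof -
    have "poly p (x + h) = poly p x + (\<Sum>i\<in>{..Polynomial.degree p} - {0}. poly (c i) x * h ^ i)"
      unfolding c by (subst sum.remove[of _ 0]) (auto simp: c0)
    also have "(\<Sum>i\<in>{..Polynomial.degree p} - {0}. poly (c i) x * h ^ i) = (\<Sum>i\<in>S. poly (c i) x * h ^ i)"
      by (rule sum.mono_neutral_right) (auto simp: S_def Suc_le_eq)
    finally show ?thesis by simp
  qed
  show ?case
  proof (cases "S = {}")
    case True
    then have const: "poly p x = poly p (s 0)" for x
      using diff[of "s 0" "x - s 0"] by simp
    obtain n where "poly p (s n) \<noteq> 0"
      using eventually_happens'[OF sequentially_bot pc_eventually_poly_nz[OF s less.prems]] by blast
    then have "0 < N (poly p (s 0))" using const[of "s n"] by simp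
    moreover have "N (poly p (s n)) = N (poly p (s 0)) * ?r n ^ 0" for n
      using const[of "s n"] by simp
    ultimately have "0 < N (poly p (s 0)) \<and>
        (\<forall>\<^sub>F n in sequentially. N (poly p (s n)) = N (poly p (s 0)) * ?r n ^ 0)"
      by (intro conjI always_eventually allI)
    then show ?thesis by blast
  next
    case False
    have "\<exists>C k. 0 < C \<and> (\<forall>\<^sub>F n in sequentially. N (poly (c i) (s n)) = C * ?r n ^ k)"
      if "i \<in> S" for i
      using that deg[of i] by (intro less.hyps) (auto simp: S_def)
    then obtain C l where Cpos: "\<And>i. i \<in> S \<Longrightarrow> 0 < C i"
      and C: "\<And>i. i \<in> S \<Longrightarrow> \<forall>\<^sub>F n in sequentially. N (poly (c i) (s n)) = C i * ?r n ^ l i"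
      by metis
    \<comment> \<open>\<open>B i\<close> is the limit of |c_i(s_m)| for m to infinity. Hence
      \<open>B i * ?r n ^ i\<close> is the limiting size of the i-th Taylor term when
      \<open>n\<close> is fixed.\<close>
    define B where "B i = C i * \<rho> ^ l i" for i
    have Bpos: "0 < B i" if "i \<in> S" for i using Cpos[OF that] rho_pos by (simp add: B_def)
    have "\<exists>k\<in>S. \<forall>\<^sub>F n in sequentially. \<forall>i\<in>S - {k}. B i * ?r n ^ i < B k * ?r n ^ k"
    proof (rule eventually_dominant[OF \<open>finite S\<close> False])
      fix i j assume "i \<in> S" "j \<in> S" "i \<noteq> j"
      then show "(\<forall>\<^sub>F n in sequentially. B i * ?r n ^ i < B j * ?r n ^ j) \<or>
          (\<forall>\<^sub>F n in sequentially. B j * ?r n ^ j < B i * ?r n ^ i)"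
        using monomials_eventually_ordered[OF pc_tendsto[OF s] rgt rho_pos Bpos Bpos, of i j i j]
          monomials_eventually_ordered[OF pc_tendsto[OF s] rgt rho_pos Bpos Bpos, of j i j i]
        by (cases "i < j") auto
    qed
    then obtain k n0 where k: "k \<in> S"
      and n0: "\<And>n i. n0 \<le> n \<Longrightarrow> i \<in> S - {k} \<Longrightarrow> B i * ?r n ^ i < B k * ?r n ^ k"
      unfolding eventually_sequentially by blast
    have k1: "1 \<le> k" using k by (simp add: S_def)
    have lim: "(\<lambda>m. C i * ?r m ^ l i * ?r n ^ i) \<longlonglongrightarrow> B i * ?r n ^ i" for i n
      unfolding B_def by (intro tendsto_intros pc_tendsto[OF s])
    have step: "\<forall>\<^sub>F m in sequentially. N (poly p (s n) - poly p (s m)) = C k * ?r m ^ l k * ?r n ^ k"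
      if n: "n0 \<le> n" for n
    proof -
      have "\<forall>\<^sub>F m in sequentially. \<forall>i\<in>S - {k}. C i * ?r m ^ l i * ?r n ^ i < C k * ?r m ^ l k * ?r n ^ k"
      proof (rule eventually_ball_finite)
        show "finite (S - {k})" using \<open>finite S\<close> by simp
        show "\<forall>i\<in>S - {k}. \<forall>\<^sub>F m in sequentially. C i * ?r m ^ l i * ?r n ^ i < C k * ?r m ^ l k * ?r n ^ k"
        proof
          fix i assume "i \<in> S - {k}"
          \<comment> \<open>A number strictly between the two limits separates the terms themselves
            for all late \<open>m\<close>.\<close>
          then obtain z where z: "B i * ?r n ^ i < z" "z < B k * ?r n ^ k"
            using n0[OF n] dense by blast
          from order_tendstoD(2)[OF lim z(1)] order_tendstoD(1)[OF lim z(2)]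
          show "\<forall>\<^sub>F m in sequentially. C i * ?r m ^ l i * ?r n ^ i < C k * ?r m ^ l k * ?r n ^ k"
            by eventually_elim linarith
        qed
      qed
      moreover have "\<forall>\<^sub>F m in sequentially. \<forall>i\<in>S. N (poly (c i) (s m)) = C i * ?r m ^ l i"
        using \<open>finite S\<close> C by (intro eventually_ball_finite) auto
      moreover have "\<forall>\<^sub>F m in sequentially. n < m" by (rule eventually_gt_at_top)
      ultimately show ?thesis
      proof eventually_elim
        case (elim m)
        let ?f = "\<lambda>i. poly (c i) (s m) * (s n - s m) ^ i"
        have d: "N (s n - s m) = ?r n" using pc_dist[OF s elim(3)] by (simp add: N_commute)
        have f: "N (?f i) = C i * ?r m ^ l i * ?r n ^ i" if "i \<in> S" for i
          using elim(2) that by (simp add: N_mult N_power d)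
        have "0 < N (?f k)" unfolding f[OF k] using Cpos[OF k] rpos by simp
        then have "?f k \<noteq> 0" by (rule iffD1[OF N_pos_iff])
        then have "N (sum ?f S) = N (?f k)"
          by (rule N_sum_dominant[OF \<open>finite S\<close> k]) (use elim(1) f k in auto)
        then show ?case using diff[of "s m" "s n - s m"] f[OF k] by simp
      qed
    qed
    show ?thesis
    \<comment> \<open>If such an \<open>n\<close> exists, p(s_m) - p(s_n) is smaller than p(s_n) for
      all late \<open>m\<close>, so |p(s_m)| is eventually constant and the exponent is 0. Otherwise
      \<open>B k * ?r n ^ k\<close> is an upper bound from \<open>n0\<close> on, and equality
      remains to be shown.\<close>
    proof (cases "\<exists>n\<ge>n0. B k * ?r n ^ k < N (poly p (s n))")
      case True
      then obtain n where n: "n0 \<le> n" "B k * ?r n ^ k < N (poly p (s n))" by blast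
      have "0 < B k * ?r n ^ k" using Bpos[OF k] rpos by simp
      with n have "0 < N (poly p (s n))" by linarith
      moreover have "\<forall>\<^sub>F m in sequentially. N (poly p (s m)) = N (poly p (s n)) * ?r m ^ 0"
        using step[OF n(1)] order_tendstoD(2)[OF lim n(2)]
      proof eventually_elim
        case (elim m)
        then have "N (poly p (s m) - poly p (s n)) < N (poly p (s n))" by (simp add: N_commute)
        from N_add_eq[OF this] show ?case by simp
      qed
      ultimately show ?thesis by blast
    next
      case False
      have "N (poly p (s n)) = B k * ?r n ^ k" if n: "n0 \<le> n" for n
      proof -
        have "\<forall>\<^sub>F m in sequentially. n < m" by (rule eventually_gt_at_top)
        with step[OF n] obtain m where m: "n < m"
          "N (poly p (s n) - poly p (s m)) = C k * ?r m ^ l k * ?r n ^ k"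
          using eventually_happens'[OF sequentially_bot eventually_conj] by blast
        \<comment> \<open>The difference p(s_n) - p(s_m) has size at least
          \<open>B k * ?r n ^ k\<close>. Since \<open>k\<close> is positive and the gaps decrease,
          the upper bound at \<open>m\<close> is strictly smaller, so p(s_n) has the size of the
          difference.\<close>
        have "B k * ?r n ^ k \<le> C k * ?r m ^ l k * ?r n ^ k"
          unfolding B_def using Cpos[OF k] rho_pos rgt[of m] rpos
          by (intro mult_right_mono mult_left_mono power_mono) (auto simp: less_imp_le)
        moreover have "N (poly p (s m)) \<le> B k * ?r m ^ k"
          using False n m(1) by (meson le_trans less_imp_le not_less)
        moreover have "B k * ?r m ^ k < B k * ?r n ^ k"
          using Bpos[OF k] rpos[of m] pc_gap_less[OF s m(1)] k1
          by (intro mult_strict_left_mono power_strict_mono) (auto simp: less_imp_le)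
        ultimately have lt: "N (poly p (s m)) < N (poly p (s n) - poly p (s m))"
          and ge: "B k * ?r n ^ k \<le> N (poly p (s n) - poly p (s m))" using m(2) by auto
        from N_add_eq[OF lt] ge have "B k * ?r n ^ k \<le> N (poly p (s n))" by simp
        then show ?thesis using False n by force
      qed
      then show ?thesis using Bpos[OF k] unfolding eventually_sequentially by blast
    qed
  qed
qed

subsection \<open>The distance of two sequences and equality of their rings\<close>

definition Dist :: "(nat \<Rightarrow> 'a) \<Rightarrow> (nat \<Rightarrow> 'a) \<Rightarrow> real" where
  "Dist s t = lim (\<lambda>n. max (N (s n - t n) - \<rho>) 0)"

text \<open>From index \<open>n\<close> on, both sequences move by at most the larger of their gaps
  at \<open>n\<close>. By the ultrametric inequality the truncated distances then vary by at most
  that gap minus \<rho>, which tends to 0, so they form a Cauchy sequence.\<close>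

lemma Dist_tendsto:
  assumes s: "pc s" and t: "pc t"
  shows "(\<lambda>n. max (N (s n - t n) - \<rho>) 0) \<longlonglongrightarrow> Dist s t"
proof -
  let ?e = "\<lambda>n. max (gap s n) (gap t n)"
  have "?e \<longlonglongrightarrow> max \<rho> \<rho>"
    by (intro tendsto_max pc_tendsto s t)
  then have lim: "?e \<longlonglongrightarrow> \<rho>" by simp
  have close: "\<bar>max (N (s n - t n) - \<rho>) 0 - max (N (s m - t m) - \<rho>) 0\<bar> \<le> ?e n - \<rho>"
    if "n \<le> m" for m n
  proof -
    have "N (s m - s n) \<le> gap s n" "N (t m - t n) \<le> gap t n"
      using pc_dist_le s t that by auto
    moreover have "N ((s m - s n) - (t m - t n)) \<le> max (N (s m - s n)) (N (t m - t n))"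
      by (rule N_diff_le)
    ultimately have e: "N ((s m - s n) - (t m - t n)) \<le> ?e n" by linarith
    have "N (s n - t n) \<le> max (N (s m - t m)) (?e n)"
      using N_diff_le[of "s m - t m" "(s m - s n) - (t m - t n)"] e
      by (simp add: algebra_simps)
    moreover have "N (s m - t m) \<le> max (N (s n - t n)) (?e n)"
      using N_add_le[of "s n - t n" "(s m - s n) - (t m - t n)"] e
      by (simp add: algebra_simps)
    moreover have "\<rho> < ?e n" using pc_gap_gt[OF s, of n] by linarith
    ultimately show ?thesis by linarith
  qed
  have "Cauchy (\<lambda>n. max (N (s n - t n) - \<rho>) 0)"
  proof (rule CauchyI')
    fix \<epsilon> :: real assume "0 < \<epsilon>"
    then have "\<forall>\<^sub>F n in sequentially. ?e n < \<rho> + \<epsilon>"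
      using lim by (intro order_tendstoD(2)) auto
    then obtain M where M: "\<And>n. M \<le> n \<Longrightarrow> ?e n < \<rho> + \<epsilon>"
      unfolding eventually_sequentially by blast
    show "\<exists>M. \<forall>m\<ge>M. \<forall>n>m. dist (max (N (s m - t m) - \<rho>) 0) (max (N (s n - t n) - \<rho>) 0) < \<epsilon>"
    proof (intro exI allI impI)
      fix m n assume "M \<le> m" "m < n"
      with close[of m n] M[of m]
      show "dist (max (N (s m - t m) - \<rho>) 0) (max (N (s n - t n) - \<rho>) 0) < \<epsilon>"
        unfolding dist_real_def by linarith
    qed
  qed
  then show ?thesis
    unfolding Dist_def by (simp add: Cauchy_convergent_iff convergent_LIMSEQ_iff)
qed

lemma Dist_less_eventually:
  assumes "pc s" "pc t" "Dist s t < c - \<rho>"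
  shows "\<forall>\<^sub>F n in sequentially. N (s n - t n) < c"
  using order_tendstoD(2)[OF Dist_tendsto[OF assms(1,2)] assms(3)]
  by eventually_elim simp

lemma Dist_le:
  assumes "pc s" "pc t" "\<rho> \<le> c" "\<forall>\<^sub>F n in sequentially. N (s n - t n) \<le> c"
  shows "Dist s t \<le> c - \<rho>"
proof (rule tendsto_upperbound[OF Dist_tendsto[OF assms(1,2)]])
  show "\<forall>\<^sub>F n in sequentially. max (N (s n - t n) - \<rho>) 0 \<le> c - \<rho>"
    using assms(4) by eventually_elim (use assms(3) in auto)
qed simp

lemma Dist_nonneg: "pc s \<Longrightarrow> pc t \<Longrightarrow> 0 \<le> Dist s t"
  by (rule tendsto_lowerbound[OF Dist_tendsto]) auto

lemma Dist_commute: "Dist s t = Dist t s"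
  unfolding Dist_def by (simp add: N_commute)

lemma Dist_triangle:
  assumes "pc s" "pc t" "pc u"
  shows "Dist s u \<le> Dist s t + Dist t u"
proof (rule tendsto_le[OF sequentially_bot tendsto_add[OF Dist_tendsto Dist_tendsto] Dist_tendsto])
  show "\<forall>\<^sub>F n in sequentially. max (N (s n - u n) - \<rho>) 0
      \<le> max (N (s n - t n) - \<rho>) 0 + max (N (t n - u n) - \<rho>) 0"
  proof (intro always_eventually allI)
    fix n show "max (N (s n - u n) - \<rho>) 0
      \<le> max (N (s n - t n) - \<rho>) 0 + max (N (t n - u n) - \<rho>) 0"
      using N_triangle[of "s n" "u n" "t n"] by linarith
  qed
qed (use assms in auto)

section \<open>Rings of sequences and integrality of rational functions at a point\<close>

abbreviation vring :: "(nat \<Rightarrow> 'a) \<Rightarrow> 'a poly fract set" where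
  "vring s \<equiv> seq_ring {x. N x \<le> 1} s"

definition integral_at :: "'a poly fract \<Rightarrow> 'a \<Rightarrow> bool" where
  "integral_at \<phi> x \<longleftrightarrow> (\<exists>y\<in>{x. N x \<le> 1}. ratfun_value \<phi> x y)"

lemma mem_vring: "\<phi> \<in> vring s \<longleftrightarrow> (\<forall>\<^sub>F n in sequentially. integral_at \<phi> (s n))"
  by (simp add: seq_ring_def integral_at_def)

text \<open>Two fractions for the same function, both with nonvanishing denominator at
  \<open>x\<close>, have the same value there by cross multiplication. So the given \<open>p\<close>
  and \<open>q\<close> may be used.\<close>

lemma integral_at_Fract:
  assumes "poly q x \<noteq> 0"
  shows "integral_at (Fraction_Field.Fract p q) x \<longleftrightarrow> N (poly p x) \<le> N (poly q x)"
proof -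
  have "ratfun_value (Fraction_Field.Fract p q) x y \<longleftrightarrow> y = poly p x / poly q x" for y
  proof
    assume "ratfun_value (Fraction_Field.Fract p q) x y"
    then obtain p' q' where eq: "Fraction_Field.Fract p q = Fraction_Field.Fract p' q'"
      and q': "poly q' x \<noteq> 0" and y: "y = poly p' x / poly q' x"
      unfolding ratfun_value_def by blast
    have "q \<noteq> 0" "q' \<noteq> 0" using assms q' by auto
    then have "poly (p * q') x = poly (p' * q) x" using eq by (simp add: eq_fract)
    then show "y = poly p x / poly q x" using assms q' by (simp add: y frac_eq_eq)
  qed (use assms in \<open>auto simp: ratfun_value_def\<close>)
  moreover have "0 < N (poly q x)" using assms by simp
  ultimately show ?thesis by (simp add: integral_at_def N_divide)
qed

text \<open>Nonzero numerators and denominators both have eventually monomial size in the gap, and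
  two such monomials are eventually ordered.\<close>

lemma integral_at_dichotomy:
  assumes s: "pc s"
  shows "(\<forall>\<^sub>F n in sequentially. integral_at \<phi> (s n)) \<or>
         (\<forall>\<^sub>F n in sequentially. \<not> integral_at \<phi> (s n))"
proof -
  obtain p q where \<phi>: "\<phi> = Fraction_Field.Fract p q" and q: "q \<noteq> 0"
    by (cases \<phi>) auto
  have ev: "\<forall>\<^sub>F n in sequentially. integral_at \<phi> (s n) \<longleftrightarrow> N (poly p (s n)) \<le> N (poly q (s n))"
    using pc_eventually_poly_nz[OF s q] by eventually_elim (simp add: \<phi> integral_at_Fract)
  have "(\<forall>\<^sub>F n in sequentially. N (poly p (s n)) \<le> N (poly q (s n))) \<or>
        (\<forall>\<^sub>F n in sequentially. N (poly q (s n)) < N (poly p (s n)))"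
  proof (cases "p = 0")
    case False
    obtain A k where A: "0 < A" "\<forall>\<^sub>F n in sequentially. N (poly p (s n)) = A * gap s n ^ k"
      using pc_eventually_monomial[OF s False] by blast
    obtain B l where B: "0 < B" "\<forall>\<^sub>F n in sequentially. N (poly q (s n)) = B * gap s n ^ l"
      using pc_eventually_monomial[OF s q] by blast
    have pos: "0 < gap s n" for n using pc_gap_gt[OF s, of n] rho_pos by linarith
    note ord = monomials_eventually_ordered[OF pc_tendsto[OF s] pc_gap_gt[OF s] rho_pos]
    have "(\<forall>\<^sub>F n in sequentially. A * gap s n ^ k \<le> B * gap s n ^ l) \<or>
          (\<forall>\<^sub>F n in sequentially. B * gap s n ^ l < A * gap s n ^ k)"
    proof (cases k l rule: linorder_cases)
      case less
      from ord[OF A(1) B(1) less] show ?thesis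
        by (auto elim: eventually_mono)
    next
      case greater
      from ord[OF B(1) A(1) greater] show ?thesis
        by (auto elim: eventually_mono)
    next
      case equal
      then show ?thesis using pos by (cases "A \<le> B") (auto intro: always_eventually)
    qed
    then show ?thesis
    proof
      assume "\<forall>\<^sub>F n in sequentially. A * gap s n ^ k \<le> B * gap s n ^ l"
      with A(2) B(2) have "\<forall>\<^sub>F n in sequentially. N (poly p (s n)) \<le> N (poly q (s n))"
        by eventually_elim simp
      then show ?thesis ..
    next
      assume "\<forall>\<^sub>F n in sequentially. B * gap s n ^ l < A * gap s n ^ k"
      with A(2) B(2) have "\<forall>\<^sub>F n in sequentially. N (poly q (s n)) < N (poly p (s n))"
        by eventually_elim simp
      then show ?thesis ..
    qed
  qed simp
  then show ?thesis
  proof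
    assume "\<forall>\<^sub>F n in sequentially. N (poly p (s n)) \<le> N (poly q (s n))"
    with ev have "\<forall>\<^sub>F n in sequentially. integral_at \<phi> (s n)" by eventually_elim simp
    then show ?thesis ..
  next
    assume "\<forall>\<^sub>F n in sequentially. N (poly q (s n)) < N (poly p (s n))"
    with ev have "\<forall>\<^sub>F n in sequentially. \<not> integral_at \<phi> (s n)" by eventually_elim simp
    then show ?thesis ..
  qed
qed

text \<open>The new sequence alternates between \<open>s\<close> and \<open>t\<close>, each time
  jumping to an index so late that the two are closer there than the current gap and the next gap is
  smaller.\<close>

lemma pc_interleave:
  assumes s: "pc s" and t: "pc t" and "Dist s t = 0"
  shows "\<exists>k. strict_mono k \<and> pc (\<lambda>j. if even j then s (k j) else t (k j))"
proof -
  define w where "w j = (if even j then s else t)" for j :: nat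
  have w: "pc (w j)" for j using s t by (simp add: w_def)
  have close: "\<forall>\<^sub>F n in sequentially. N (w (Suc j) n - w j n) < c" if "\<rho> < c" for j c
    using Dist_less_eventually[OF s t, of c] \<open>Dist s t = 0\<close> that
    by (simp add: w_def N_commute)
  \<comment> \<open>The conjunct \<open>True\<close> fits the shape of
    \<open>dependent_nat_choice\<close>.\<close>
  have "\<exists>k'. True \<and> (k < k' \<and> gap (w (Suc j)) k' < gap (w j) k
      \<and> N (w (Suc j) k' - w j k) = gap (w j) k)" for k j
  proof -
    have "\<rho> < gap (w j) k" by (rule pc_gap_gt[OF w])
    then have "\<forall>\<^sub>F k' in sequentially. k < k' \<and> gap (w (Suc j)) k' < gap (w j) k
      \<and> N (w (Suc j) k' - w j k') < gap (w j) k"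
      by (intro eventually_conj eventually_gt_at_top close order_tendstoD(2)[OF pc_tendsto[OF w]])
    then obtain k' where k': "k < k'" "gap (w (Suc j)) k' < gap (w j) k"
      "N (w (Suc j) k' - w j k') < gap (w j) k"
      using eventually_happens'[OF sequentially_bot] by blast
    have d: "N (w j k' - w j k) = gap (w j) k" by (rule pc_dist[OF w k'(1)])
    \<comment> \<open>The jump consists of a move along \<open>w j\<close> from \<open>k\<close> to
      \<open>k'\<close> and a change of sequence at \<open>k'\<close>; the first part
      dominates.\<close>
    have "N (w (Suc j) k' - w j k') < N (w j k' - w j k)" using k'(3) d by simp
    from N_add_eq[OF this] d k' show ?thesis by (intro exI[of _ k']) simp
  qed
  then obtain k where k: "\<And>j. k j < k (Suc j)"
      "\<And>j. gap (w (Suc j)) (k (Suc j)) < gap (w j) (k j)"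
      "\<And>j. N (w (Suc j) (k (Suc j)) - w j (k j)) = gap (w j) (k j)"
    using dependent_nat_choice[of "\<lambda>_ _. True" "\<lambda>j k k'. k < k' \<and> gap (w (Suc j)) k' < gap (w j) k
      \<and> N (w (Suc j) k' - w j k) = gap (w j) k"] by auto
  define u where "u j = w j (k j)" for j
  have mono: "strict_mono k" using k(1) by (simp add: strict_mono_Suc_iff)
  have gap_u: "gap u j = gap (w j) (k j)" for j using k(3) by (simp add: gap_def u_def)
  have "gap u \<longlonglongrightarrow> \<rho>"
  proof (rule tendsto_sandwich[OF _ _ tendsto_const])
    show "\<forall>\<^sub>F j in sequentially. \<rho> \<le> gap u j"
      using pc_gap_gt[OF w] by (simp add: gap_u less_imp_le)
    have "gap (w j) (k j) \<le> gap (w j) j" for j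
      using pc_gap_less[OF w, of j "k j"] strict_mono_imp_increasing[OF mono, of j]
      by (cases "j = k j") (auto simp: less_imp_le)
    then show "\<forall>\<^sub>F j in sequentially. gap u j \<le> max (gap s j) (gap t j)"
      by (intro always_eventually allI) (metis gap_u max.coboundedI1 max.coboundedI2 w_def)
    show "(\<lambda>j. max (gap s j) (gap t j)) \<longlonglongrightarrow> \<rho>"
      using tendsto_max[OF pc_tendsto[OF s] pc_tendsto[OF t]] by simp
  qed
  then have "pc u" using k(2) by (simp add: pc_def gap_u)
  moreover have "u = (\<lambda>j. if even j then s (k j) else t (k j))" by (auto simp: u_def w_def)
  ultimately show ?thesis using mono by blast
qed

text \<open>The dichotomy is applied to the interleaved sequence and then to \<open>t\<close>. Late
  even indices carry integrality from \<open>s\<close> to the interleaved sequence, late odd ones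
  from there to \<open>t\<close>.\<close>

lemma vring_subset_if_Dist_0:
  assumes s: "pc s" and t: "pc t" and "Dist s t = 0"
  shows "vring s \<subseteq> vring t"
proof
  fix \<phi> assume "\<phi> \<in> vring s"
  then obtain n0 where n0: "\<And>n. n0 \<le> n \<Longrightarrow> integral_at \<phi> (s n)"
    by (auto simp: mem_vring eventually_sequentially)
  obtain k where k: "strict_mono k" "pc (\<lambda>j. if even j then s (k j) else t (k j))"
    using pc_interleave[OF assms] by blast
  have kge: "j \<le> k j" for j using strict_mono_imp_increasing[OF k(1)] .
  obtain n1 where n1: "\<And>j. n1 \<le> j \<Longrightarrow> integral_at \<phi> (if even j then s (k j) else t (k j))"
  proof -
    from integral_at_dichotomy[OF k(2), of \<phi>] show thesis
    proof
      assume "\<forall>\<^sub>F j in sequentially. \<not> integral_at \<phi> (if even j then s (k j) else t (k j))"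
      then obtain m where m: "\<And>j. m \<le> j \<Longrightarrow> \<not> integral_at \<phi> (if even j then s (k j) else t (k j))"
        by (auto simp: eventually_sequentially)
      have "n0 \<le> k (2 * (m + n0))" by (rule order_trans[OF _ kge]) simp
      with m[of "2 * (m + n0)"] n0 show thesis by simp
    qed (use that in \<open>auto simp: eventually_sequentially\<close>)
  qed
  from integral_at_dichotomy[OF t, of \<phi>] show "\<phi> \<in> vring t"
  proof
    assume "\<forall>\<^sub>F n in sequentially. \<not> integral_at \<phi> (t n)"
    then obtain m where m: "\<And>j. m \<le> j \<Longrightarrow> \<not> integral_at \<phi> (t j)"
      by (auto simp: eventually_sequentially)
    have "m \<le> k (2 * (m + n1) + 1)" by (rule order_trans[OF _ kge]) simp
    with n1[of "2 * (m + n1) + 1"] m show ?thesis by simp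
  qed (simp add: mem_vring)
qed

text \<open>The test function \<open>?\<phi>\<close> is integral exactly on the ball of radius
  \<open>gap s m\<close> around \<open>s m\<close>. It lies in the ring of \<open>s\<close>, so
  \<open>t\<close> also ends up in this ball, for every \<open>m\<close>.\<close>

lemma Dist_0_if_vring_subset:
  assumes s: "pc s" and t: "pc t" and sub: "vring s \<subseteq> vring t"
  shows "Dist s t = 0"
proof -
  have "Dist s t \<le> gap s m - \<rho>" for m
  proof (rule Dist_le[OF s t])
    let ?\<phi> = "Fraction_Field.Fract [:- s m, 1:] [:s (Suc m) - s m:]"
    have "s (Suc m) \<noteq> s m" using pc_inj[OF s] by (simp add: inj_eq)
    then have int: "integral_at ?\<phi> x \<longleftrightarrow> N (x - s m) \<le> gap s m" for x
      by (subst integral_at_Fract) (simp_all add: gap_def)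
    have le: "\<forall>\<^sub>F n in sequentially. N (s n - s m) \<le> gap s m"
      using eventually_ge_at_top[of m] by eventually_elim (rule pc_dist_le[OF s])
    then have "?\<phi> \<in> vring s" by (simp add: mem_vring int)
    then have "?\<phi> \<in> vring t" using sub by blast
    then have "\<forall>\<^sub>F n in sequentially. N (t n - s m) \<le> gap s m" by (simp add: mem_vring int)
    with le show "\<forall>\<^sub>F n in sequentially. N (s n - t n) \<le> gap s m"
    proof eventually_elim
      case (elim n)
      then show ?case using N_triangle[of "s n" "t n" "s m"] by (simp add: N_commute)
    qed
  qed (use pc_gap_gt[OF s, of m] in simp)
  moreover have "(\<lambda>m. gap s m - \<rho>) \<longlonglongrightarrow> \<rho> - \<rho>" by (intro tendsto_intros pc_tendsto s)
  ultimately have "Dist s t \<le> 0" by (intro tendsto_lowerbound[where f = "\<lambda>m. gap s m - \<rho>"]) auto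
  then show ?thesis using Dist_nonneg[OF s t] by simp
qed

lemma vring_eq_iff: "pc s \<Longrightarrow> pc t \<Longrightarrow> vring s = vring t \<longleftrightarrow> Dist s t = 0"
  using vring_subset_if_Dist_0[of s t] vring_subset_if_Dist_0[of t s]
    Dist_0_if_vring_subset[of s t] Dist_commute[of s t] by (metis order_refl subset_antisym)

text \<open>This makes the distance of two rings independent of the sequences that represent
  them.\<close>

lemma Dist_cong:
  assumes "pc s" "pc t" "pc s'" "pc t'" "vring s = vring s'" "vring t = vring t'"
  shows "Dist s t = Dist s' t'"
proof -
  have "Dist s s' = 0" "Dist t t' = 0" using vring_eq_iff assms by auto
  then show ?thesis
    using Dist_triangle[of s s' t] Dist_triangle[of s' t' t]
      Dist_triangle[of s' s t'] Dist_triangle[of s t t'] assms(1-4)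
      Dist_commute[of s s'] Dist_commute[of t t']
    by linarith
qed

subsection \<open>Density and completeness\<close>

text \<open>In the difference of consecutive terms, \<open>y j\<close> strictly dominates both
  \<open>y (Suc j)\<close> and the move of \<open>x\<close>. The gaps are therefore those prescribed
  by \<open>c\<close>, whatever \<open>x\<close> does below that size.\<close>

lemma pc_perturb:
  assumes y: "\<And>j. N (y j) = c j" and "\<And>j. c (Suc j) < c j" "c \<longlonglongrightarrow> \<rho>"
    and x: "\<And>j. N (x (Suc j) - x j) < c j"
  shows "gap (\<lambda>j. x j + y j) j = c j" "pc (\<lambda>j. x j + y j)"
proof -
  have gap_eq: "gap (\<lambda>j. x j + y j) j = c j" for j
  proof -
    have "N (y (Suc j) + (x (Suc j) - x j)) < N (- y j)"
      using N_add_le[of "y (Suc j)" "x (Suc j) - x j"] x[of j] assms(2)[of j] by (simp add: y)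
    from N_add_eq[OF this] show ?thesis by (simp add: gap_def y algebra_simps)
  qed
  then show "gap (\<lambda>j. x j + y j) j = c j" .
  have "gap (\<lambda>j. x j + y j) = c" using gap_eq by (rule ext)
  then show "pc (\<lambda>j. x j + y j)" using assms(2,3) by (simp add: pc_def)
qed

text \<open>The witness for \<alpha> is \<open>s m\<close> with \<open>gap s m\<close> close to
  \<rho>: its distance to \<open>u j\<close> is \<open>gap s j\<close>. The last conclusion says
  that \<alpha> is a pseudo-limit of \<open>u\<close>.\<close>

lemma pc_approx:
  assumes s: "pc s" and "0 < \<epsilon>"
  obtains u \<alpha> where "pc u" "Dist s u < \<epsilon>" "\<forall>n. N (\<alpha> - u (Suc n)) < N (\<alpha> - u n)"
proof -
  obtain m where m: "gap s m < \<rho> + \<epsilon>"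
    using order_tendstoD(2)[OF pc_tendsto[OF s], of "\<rho> + \<epsilon>"] \<open>0 < \<epsilon>\<close>
      eventually_happens'[OF sequentially_bot] by auto
  define y where "y j = s (Suc j) - s j" for j
  define u where "u = (\<lambda>j. s m + y j)"
  have y: "N (y j) = gap s j" for j by (simp add: y_def gap_def)
  have pos: "0 < gap s j" for j using pc_gap_gt[OF s, of j] rho_pos by linarith
  have u: "pc u" unfolding u_def
    by (rule pc_perturb(2)[OF y _ pc_tendsto[OF s]]) (simp_all add: pos pc_gap_less[OF s])
  have "Dist s u \<le> gap s m - \<rho>"
  proof (rule Dist_le[OF s u])
    show "\<forall>\<^sub>F n in sequentially. N (s n - u n) \<le> gap s m"
      using eventually_gt_at_top[of m]
    proof eventually_elim
      case (elim n)
      then show ?case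
        using N_diff_le[of "s n - s m" "y n"] pc_dist[OF s elim] pc_gap_less[OF s elim]
        by (simp add: u_def y algebra_simps)
    qed
  qed (use pc_gap_gt[OF s, of m] in simp)
  then have "Dist s u < \<epsilon>" using m by linarith
  moreover have "N (s m - u (Suc n)) < N (s m - u n)" for n
    by (simp add: u_def y pc_gap_less[OF s])
  ultimately show thesis using that u by blast
qed

lemma pc_limit:
  assumes c: "pc c"
    and S: "\<And>j. pc (S j)" and close: "\<And>i j. i \<le> j \<Longrightarrow> Dist (S i) (S j) < gap c i - \<rho>"
  obtains u where "pc u" "\<And>j. Dist (S j) u \<le> gap c j - \<rho>"
proof -
  have "\<exists>m. gap (S j) m < gap c j" for j
    \<comment> \<open>The gaps of \<open>S j\<close> tend to \<rho>, which lies strictly below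
      \<open>gap c j\<close>. The index found here makes the whole tail of \<open>S j\<close> stay
      within \<open>gap c j\<close> of \<open>x j\<close>.\<close>
    using order_tendstoD(2)[OF pc_tendsto[OF S] pc_gap_gt[OF c, of j]]
      eventually_happens'[OF sequentially_bot] by blast
  then obtain m where m: "\<And>j. gap (S j) (m j) < gap c j" by metis
  define x where "x j = S j (m j)" for j
  define y where "y j = c (Suc j) - c j" for j
  have y: "N (y j) = gap c j" for j by (simp add: y_def gap_def)
  have tail: "\<forall>\<^sub>F n in sequentially. N (x i - S i n) < gap c i" for i
    using eventually_ge_at_top[of "m i"]
  proof eventually_elim
    case (elim n)
    then show ?case using pc_dist_le[OF S[of i] elim] m[of i] by (simp add: x_def N_commute)
  qed
  have x: "N (x j - x i) < gap c i" if ij: "i \<le> j" for i j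
  proof -
    have "gap c j \<le> gap c i" using pc_gap_less[OF c, of i j] ij by (cases "i = j") auto
    \<comment> \<open>The path from \<open>x i\<close> to \<open>x j\<close> goes through
      \<open>S i n\<close> and \<open>S j n\<close> at one common late index.\<close>
    moreover obtain n where "N (x i - S i n) < gap c i" "N (x j - S j n) < gap c j"
      "N (S i n - S j n) < gap c i"
      using eventually_happens'[OF sequentially_bot eventually_conj[OF tail[of i]
        eventually_conj[OF tail[of j] Dist_less_eventually[OF S S close[OF ij]]]]] by auto
    ultimately show ?thesis
      using N_triangle[of "x j" "x i" "S j n"] N_triangle[of "S j n" "x i" "S i n"]
      by (simp add: N_commute)
  qed
  define u where "u = (\<lambda>j. x j + y j)"
  have u: "pc u" unfolding u_def
    by (rule pc_perturb(2)[OF y _ pc_tendsto[OF c]]) (simp_all add: x pc_gap_less[OF c])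
  have "Dist (S j) u \<le> gap c j - \<rho>" for j
  proof (rule Dist_le[OF S u])
    show "\<forall>\<^sub>F n in sequentially. N (S j n - u n) \<le> gap c j"
      using tail[of j] eventually_gt_at_top[of j]
    proof eventually_elim
      case (elim n)
      have "N (u n - x j) \<le> gap c j"
        using N_add_le[of "x n - x j" "y n"] x[of j n] elim(2) pc_gap_less[OF c elim(2)]
        by (simp add: u_def y algebra_simps)
      then show ?case
        using N_triangle[of "S j n" "u n" "x j"] elim(1) by (simp add: N_commute)
    qed
  qed (use pc_gap_gt[OF c, of j] in simp)
  then show thesis using that u by blast
qed

text \<open>Passes from sequences to rings. For completeness it suffices that a subsequence of each
  Cauchy sequence converges; density is \<open>pc_approx\<close>.\<close>

lemma completion:
  assumes M: "M = vring ` Collect pc"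
    and d: "\<And>s t. pc s \<Longrightarrow> pc t \<Longrightarrow> d (vring s) (vring t) = Dist s t"
    and d_outside: "\<And>A B. A \<notin> M \<or> B \<notin> M \<Longrightarrow> d A B = 0"
    and "S \<subseteq> M"
    and S: "\<And>u \<alpha>. pc u \<Longrightarrow> (\<And>n. N (\<alpha> - u (Suc n)) < N (\<alpha> - u n)) \<Longrightarrow> vring u \<in> S"
  shows "is_completion_of_subset M d S"
proof -
  interpret Metric_space M d
  proof
    fix A B C
    show "0 \<le> d A B"
      using d_outside[of A B] d Dist_nonneg unfolding M by fastforce
    show "d A B = d B A"
    proof (cases "A \<in> M \<and> B \<in> M")
      case True
      then obtain s t where "pc s" "pc t" "A = vring s" "B = vring t" unfolding M by blast
      then show ?thesis by (simp add: d Dist_commute[of s t])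
    next
      case False
      then show ?thesis using d_outside[of A B] d_outside[of B A] by auto
    qed
    assume "A \<in> M" "B \<in> M"
    then obtain s t where st: "pc s" "pc t" "A = vring s" "B = vring t" unfolding M by blast
    then show "d A B = 0 \<longleftrightarrow> A = B" by (simp add: d vring_eq_iff)
    assume "C \<in> M"
    then obtain u where "pc u" "C = vring u" unfolding M by blast
    with st show "d A C \<le> d A B + d B C" by (simp add: d Dist_triangle)
  qed
  have "mcomplete"
    unfolding mcomplete_def
  proof (intro allI impI)
    fix \<sigma> assume cau: "MCauchy \<sigma>"
    then have "\<sigma> k \<in> M" for k unfolding MCauchy_def by blast
    then have "\<forall>k. \<exists>s. pc s \<and> \<sigma> k = vring s" unfolding M by blast
    \<comment> \<open>In this block \<open>S\<close> denotes representing sequences and hides the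
      subset \<open>S\<close> of the statement.\<close>
    then obtain S where S: "\<And>k. pc (S k)" "\<And>k. \<sigma> k = vring (S k)" by metis
    \<comment> \<open>Only the gaps of \<open>c\<close> matter, as radii decreasing strictly to
      \<rho>. A field need not contain such a sequence (a discrete value group excludes it), so one
      is taken from the Cauchy sequence.\<close>
    define c where "c = S 0"
    have c: "pc c" by (simp add: c_def S)
    have gap_gt: "\<rho> < gap c j" for j by (rule pc_gap_gt[OF c])
    have "\<exists>n. \<forall>k l. n \<le> k \<longrightarrow> n \<le> l \<longrightarrow> Dist (S k) (S l) < gap c j - \<rho>" for j
      using cau gap_gt[of j] unfolding MCauchy_def by (simp add: S d)
    then obtain n where n: "\<And>j k l. n j \<le> k \<Longrightarrow> n j \<le> l \<Longrightarrow> Dist (S k) (S l) < gap c j - \<rho>"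
      by metis
    \<comment> \<open>Partial sums make \<open>r\<close> strictly increasing and at least
      \<open>n j\<close> at \<open>j\<close>.\<close>
    define r where "r j = (\<Sum>i\<le>j. Suc (n i))" for j
    have r: "strict_mono r" by (simp add: strict_mono_Suc_iff r_def)
    have n_le: "n j \<le> r j" for j unfolding r_def by (cases j) auto
    have "Dist (S (r i)) (S (r j)) < gap c i - \<rho>" if "i \<le> j" for i j
    proof (rule n[OF n_le])
      have "r i \<le> r j" using r that by (simp add: strict_mono_less_eq)
      then show "n i \<le> r j" using n_le[of i] by linarith
    qed
    then obtain u where u: "pc u" "\<And>j. Dist (S (r j)) u \<le> gap c j - \<rho>"
      using pc_limit[OF c, of "\<lambda>j. S (r j)"] S(1) by blast
    have "limitin mtopology (\<sigma> \<circ> r) (vring u) sequentially"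
      unfolding limitin_metric
    proof (intro conjI allI impI)
      show "vring u \<in> M" using u(1) by (simp add: M)
      fix \<epsilon> :: real assume "0 < \<epsilon>"
      then have "\<forall>\<^sub>F j in sequentially. gap c j < \<rho> + \<epsilon>"
        by (intro order_tendstoD(2)[OF pc_tendsto[OF c]]) simp
      then show "\<forall>\<^sub>F j in sequentially. (\<sigma> \<circ> r) j \<in> M \<and> d ((\<sigma> \<circ> r) j) (vring u) < \<epsilon>"
      proof eventually_elim
        case (elim j)
        then show ?case using u(2)[of j] by (simp add: S d u(1) M)
      qed
    qed
    with MCauchy_convergent_subsequence[OF cau r]
    show "\<exists>A. limitin mtopology \<sigma> A sequentially" by blast
  qed
  moreover have "mtopology closure_of S = M"
  proof
    show "M \<subseteq> mtopology closure_of S"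
      unfolding metric_closure_of
    proof (intro subsetI CollectI conjI allI impI)
      fix A and \<epsilon> :: real assume "A \<in> M" "0 < \<epsilon>"
      then obtain s where s: "pc s" "A = vring s" unfolding M by blast
      obtain u \<alpha> where u: "pc u" "Dist s u < \<epsilon>" "\<forall>n. N (\<alpha> - u (Suc n)) < N (\<alpha> - u n)"
        using pc_approx[OF s(1) \<open>0 < \<epsilon>\<close>] by blast
      then have "vring u \<in> S" using S by blast
      moreover have "vring s \<in> M" "vring u \<in> M" using s u by (simp_all add: M)
      then have "vring u \<in> mball A \<epsilon>" unfolding in_mball using u s by (simp add: d)
      ultimately show "\<exists>B\<in>S. B \<in> mball A \<epsilon>" by blast
    qed
  qed (auto simp: metric_closure_of)
  ultimately show ?thesis
    unfolding is_completion_of_subset_def using \<open>S \<subseteq> M\<close> Metric_space_axioms by blast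
qed

end

subsection \<open>From the valuation to the absolute value\<close>

lemma val_dist_eq: "val_dist v x y = val_dist v (x - y) 0"
  by (simp add: val_dist_def)

context
  fixes V :: "'a::field set" and v :: "'a \<Rightarrow> ereal" and \<delta> :: real
  assumes v: "real_valuation_of V v"
begin

lemma val_eq_PInf_iff: "v x = \<infinity> \<longleftrightarrow> x = 0"
  using v by (simp add: real_valuation_of_def)

lemma val_not_MInf: "v x \<noteq> -\<infinity>"
  using v by (simp add: real_valuation_of_def)

lemma val_real:
  assumes "x \<noteq> 0" obtains a where "v x = ereal a" "val_dist v x 0 = exp (- a)"
proof (cases "v x")
  case (real a)
  then show ?thesis using that assms by (simp add: val_dist_def)
qed (use assms val_eq_PInf_iff[of x] val_not_MInf[of x] in auto)

lemma val_dist_less_iff: "val_dist v x 0 < val_dist v y 0 \<longleftrightarrow> v y < v x"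
proof (cases "x = 0 \<or> y = 0")
  \<comment> \<open>Zero is separate because \<open>val_dist\<close> assigns it 0 by definition;
    \<open>real_of_ereal\<close> sends the infinite value to 0, so the exponential formula would
    give 1.\<close>
  case True
  have "v z < v 0" if z: "z \<noteq> 0" for z
  proof -
    obtain a where "v z = ereal a" using val_real[OF z] by blast
    moreover have "ereal a < v 0" by (simp add: val_eq_PInf_iff[THEN iffD2])
    ultimately show ?thesis by simp
  qed
  then show ?thesis using True by (auto simp: val_dist_def dest: less_asym)
next
  case False
  then obtain a b where "v x = ereal a" "val_dist v x 0 = exp (- a)"
    "v y = ereal b" "val_dist v y 0 = exp (- b)" by (meson val_real)
  then show ?thesis by simp
qed

lemma nonarch_abs_val_dist: "nonarch_abs (\<lambda>x. val_dist v x 0) (exp (- \<delta>))"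
proof
  fix x y
  show "val_dist v (x * y) 0 = val_dist v x 0 * val_dist v y 0"
  proof (cases "x = 0 \<or> y = 0")
    case False
    then obtain a b where "v x = ereal a" "val_dist v x 0 = exp (- a)"
      "v y = ereal b" "val_dist v y 0 = exp (- b)" by (meson val_real)
    moreover have "v (x * y) = v x + v y" using v by (simp add: real_valuation_of_def)
    ultimately show ?thesis using False by (simp add: val_dist_def exp_add[symmetric])
  qed (auto simp: val_dist_def)
  have "min (v x) (v y) \<le> v (x + y)" using v by (simp add: real_valuation_of_def)
  then show "val_dist v (x + y) 0 \<le> max (val_dist v x 0) (val_dist v y 0)"
    using val_dist_less_iff[of x "x + y"] val_dist_less_iff[of y "x + y"]
    by (auto simp: not_less[symmetric] min_def max_def split: if_splits)
qed (auto simp: val_dist_def)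

interpretation nonarch_abs "\<lambda>x. val_dist v x 0" "exp (- \<delta>)"
  by (rule nonarch_abs_val_dist)

lemma valuation_ring_eq: "V = {x. val_dist v x 0 \<le> 1}"
proof -
  have "v 1 = v 1 + v 1" using v unfolding real_valuation_of_def by (metis mult_1)
  moreover obtain a where "v 1 = ereal a" using val_real[of 1] by auto
  ultimately have "v 1 = 0" by simp
  then have "val_dist v x 0 \<le> 1 \<longleftrightarrow> 0 \<le> v x" for x
    using val_dist_less_iff[of 1 x] N_1 by (simp add: not_less[symmetric])
  then show ?thesis using v by (simp add: real_valuation_of_def)
qed

text \<open>\<open>breadth\<close> uses \<open>lim\<close>, which is informative only for convergent
  sequences. Pseudo-convergence makes the values increasing, so they converge to their supremum; exp
  and ln then translate the limit.\<close>

lemma pseudo_convergent_breadth_iff: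
  "pseudo_convergent v s \<and> breadth v s = ereal \<delta> \<longleftrightarrow> pc s"
proof -
  let ?w = "\<lambda>n. v (s (Suc n) - s n)"
  have dec_iff: "pseudo_convergent v s \<longleftrightarrow> (\<forall>n. gap s (Suc n) < gap s n)"
    by (simp add: pseudo_convergent_def gap_def val_dist_less_iff)
  have "breadth v s = ereal \<delta> \<longleftrightarrow> gap s \<longlonglongrightarrow> exp (- \<delta>)"
    if dec: "\<And>n. gap s (Suc n) < gap s n"
  proof -
    \<comment> \<open>Each gap exceeds a nonnegative one, so all these values are real
      numbers.\<close>
    have "s (Suc n) - s n \<noteq> 0" for n
      using dec[of n] N_nonneg[of "s (Suc (Suc n)) - s (Suc n)"]
      unfolding gap_def by (intro iffD1[OF N_pos_iff]) linarith
    then have "\<exists>a. ?w n = ereal a \<and> gap s n = exp (- a)" for n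
      unfolding gap_def by (meson val_real)
    then obtain a where a: "\<And>n. ?w n = ereal (a n)" "\<And>n. gap s n = exp (- a n)" by metis
    have "incseq ?w"
      using dec by (intro incseq_SucI) (simp add: a less_imp_le)
    then have conv: "?w \<longlonglongrightarrow> (SUP n. ?w n)" by (rule LIMSEQ_SUP)
    have "breadth v s = (SUP n. ?w n)"
      unfolding breadth_def using limI[OF conv] by simp
    then have "breadth v s = ereal \<delta> \<longleftrightarrow> ?w \<longlonglongrightarrow> ereal \<delta>"
      using conv LIMSEQ_unique by metis
    also have "\<dots> \<longleftrightarrow> a \<longlonglongrightarrow> \<delta>" by (simp add: a)
    also have "\<dots> \<longleftrightarrow> gap s \<longlonglongrightarrow> exp (- \<delta>)"
    proof
      assume "a \<longlonglongrightarrow> \<delta>"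
      then show "gap s \<longlonglongrightarrow> exp (- \<delta>)" unfolding a(2) by (intro tendsto_intros)
    next
      assume "gap s \<longlonglongrightarrow> exp (- \<delta>)"
      then have "(\<lambda>n. - ln (gap s n)) \<longlonglongrightarrow> - ln (exp (- \<delta>))" by (intro tendsto_intros) auto
      then show "a \<longlonglongrightarrow> \<delta>" by (simp add: a(2))
    qed
    finally show ?thesis .
  qed
  then show ?thesis by (auto simp: dec_iff pc_def)
qed

lemma seq_rings_eq: "seq_rings V v \<delta> = vring ` Collect pc"
  unfolding seq_rings_def valuation_ring_eq[symmetric]
  by (auto simp: pseudo_convergent_breadth_iff)

text \<open>The described number exists by \<open>Dist_tendsto\<close> and \<open>Dist_cong\<close>;
  it is unique because \<open>s\<close> and \<open>t\<close> themselves represent the two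
  rings.\<close>

lemma d_delta_eq_Dist:
  assumes "pc s" "pc t"
  shows "d_delta V v \<delta> (vring s) (vring t) = Dist s t"
proof -
  have "(THE r. \<forall>s' t'.
           pseudo_convergent v s' \<and> breadth v s' = ereal \<delta> \<and> seq_ring V s' = vring s \<and>
           pseudo_convergent v t' \<and> breadth v t' = ereal \<delta> \<and> seq_ring V t' = vring t \<longrightarrow>
           (\<lambda>n. max (val_dist v (s' n) (t' n) - exp (- \<delta>)) 0) \<longlonglongrightarrow> r) = Dist s t"
  proof (rule the_equality)
    show "\<forall>s' t'.
           pseudo_convergent v s' \<and> breadth v s' = ereal \<delta> \<and> seq_ring V s' = vring s \<and>
           pseudo_convergent v t' \<and> breadth v t' = ereal \<delta> \<and> seq_ring V t' = vring t \<longrightarrow>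
           (\<lambda>n. max (val_dist v (s' n) (t' n) - exp (- \<delta>)) 0) \<longlonglongrightarrow> Dist s t"
    proof (intro allI impI)
      fix s' t'
      assume "pseudo_convergent v s' \<and> breadth v s' = ereal \<delta> \<and> seq_ring V s' = vring s \<and>
           pseudo_convergent v t' \<and> breadth v t' = ereal \<delta> \<and> seq_ring V t' = vring t"
      then have *: "pc s'" "pc t'" "vring s' = vring s" "vring t' = vring t"
        using pseudo_convergent_breadth_iff valuation_ring_eq by auto
      then have "Dist s' t' = Dist s t" using Dist_cong assms by blast
      with Dist_tendsto[OF *(1,2)]
      show "(\<lambda>n. max (val_dist v (s' n) (t' n) - exp (- \<delta>)) 0) \<longlonglongrightarrow> Dist s t"
        by (simp add: val_dist_eq[of v "s' _" "t' _"])
    qed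
  next
    fix r
    assume "\<forall>s' t'.
           pseudo_convergent v s' \<and> breadth v s' = ereal \<delta> \<and> seq_ring V s' = vring s \<and>
           pseudo_convergent v t' \<and> breadth v t' = ereal \<delta> \<and> seq_ring V t' = vring t \<longrightarrow>
           (\<lambda>n. max (val_dist v (s' n) (t' n) - exp (- \<delta>)) 0) \<longlonglongrightarrow> r"
    then have "(\<lambda>n. max (val_dist v (s n) (t n) - exp (- \<delta>)) 0) \<longlonglongrightarrow> r"
      using assms pseudo_convergent_breadth_iff valuation_ring_eq by auto
    then have "(\<lambda>n. max (val_dist v (s n - t n) 0 - exp (- \<delta>)) 0) \<longlonglongrightarrow> r"
      by (simp add: val_dist_eq[of v "s _" "t _"])
    with Dist_tendsto[OF assms] show "r = Dist s t" by (rule LIMSEQ_unique[rotated])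
  qed
  moreover have "vring s \<in> seq_rings V v \<delta>" "vring t \<in> seq_rings V v \<delta>"
    using assms by (auto simp: seq_rings_eq)
  ultimately show ?thesis by (simp add: d_delta_def)
qed

lemma completion_seq_rings:
  "is_completion_of_subset (seq_rings V v \<delta>) (d_delta V v \<delta>) (seq_rings_K V v \<delta>)"
proof (rule completion[OF seq_rings_eq d_delta_eq_Dist])
  show "d_delta V v \<delta> A B = 0" if "A \<notin> seq_rings V v \<delta> \<or> B \<notin> seq_rings V v \<delta>" for A B
    using that by (auto simp: d_delta_def)
  show "seq_rings_K V v \<delta> \<subseteq> seq_rings V v \<delta>"
    by (auto simp: seq_rings_def seq_rings_K_def)
  fix u \<alpha> assume "pc u" and "\<And>n. val_dist v (\<alpha> - u (Suc n)) 0 < val_dist v (\<alpha> - u n) 0"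
  then have "pseudo_convergent v u \<and> breadth v u = ereal \<delta>" "pseudo_limit v u \<alpha>"
    by (simp_all add: pseudo_convergent_breadth_iff pseudo_limit_def val_dist_less_iff)
  then show "vring u \<in> seq_rings_K V v \<delta>"
    unfolding seq_rings_K_def valuation_ring_eq[symmetric] by blast
qed

end

theorem proposition3p4:
  fixes V :: "'a::field set" and v :: "'a \<Rightarrow> ereal" and \<delta> :: real
  assumes "rank_one_valuation_domain V"
    and "real_valuation_of V v"
  shows "is_completion_of_subset (seq_rings V v \<delta>) (d_delta V v \<delta>) (seq_rings_K V v \<delta>) \<and>
    Metric_space (seq_rings V v \<delta>) (d_delta V v \<delta>) \<and>
    Metric_space.mcomplete (seq_rings V v \<delta>) (d_delta V v \<delta>)"
  using completion_seq_rings[OF assms(2)] by (simp add: is_completion_of_subset_def)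

end
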